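(* Let $\mathcal Z=V(F)\subset\mathbb P^3$ with $F\in\mathbb C[x,y,z,t]$ homogeneous of degree $d\ge2$, let $S\in\mathbb P^3$, let $U\subseteq\mathcal Z$ and let $\psi:U\to\mathbb P^3$ be given by $$\boldsymbol\psi(\mathbf m)=\lambda_0(\mathbf m)\cdot\mathbf m+\lambda_1(\mathbf m)\cdot\boldsymbol\sigma(\mathbf m)\in\mathbf W,$$ with $\lambda_0(\cdot)$ and $\lambda_1(\cdot)$ in an integral extension of $\operatorname{Sym}(\mathbf W^\vee)=\mathbb C[x,y,z,t]$ such that $$\alpha(\mathbf m)(\lambda_0(\mathbf m))^2+\beta(\mathbf m)\lambda_0(\mathbf m)\lambda_1(\mathbf m)+\gamma(\mathbf m)(\lambda_1(\mathbf m))^2=0,$$ where $$\alpha=\Delta_{\mathbf S}F,\qquad \beta=-2\left[\operatorname{Hess}_F(\mathbf S,\boldsymbol\sigma)+(\Delta_{\mathbf S}F)^2(F_{xx}+F_{yy}+F_{zz})\right],\qquad \gamma=-\frac{4\Delta_{\mathbf S}F}{(d-1)^2}N_{\mathbf S}\,H_F$$ (homogeneous of degrees $d-1$, $3d-4$, $5d-7$ respectively). Then, for every $m\in\mathcal Z\setminus V(t\,Q(\nabla F))$ (at which $\psi$ is defined), the reflected line $\mathcal R_m=(m\,\sigma(m))$ is tangent to $\psi(\mathcal Z)$ at $\psi(m)$.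
   Context: $\mathbf W=\mathbb C^4$ with coordinates $(x,y,z,t)$, $\mathbb P^3=\mathbb P(\mathbf W)$; $\mathbf m\in\mathbf W\setminus\{0\}$ denotes a representative of $m\in\mathbb P^3$; $S=[x_0:y_0:z_0:t_0]$, $\mathbf S=(x_0,y_0,z_0,t_0)$. $Q(x,y,z,t)=x^2+y^2+z^2$, $\boldsymbol\kappa(a,b,c,e)=(a,b,c,0)$, $\nabla F=(F_x,F_y,F_z,F_t)$, $\Delta_{\mathbf S}F=x_0F_x+y_0F_y+z_0F_z+t_0F_t$, $N_{\mathbf S}=(xt_0-x_0t)^2+(yt_0-y_0t)^2+(zt_0-z_0t)^2$, $\operatorname{Hess}_F$ is the Hessian bilinear form of $F$ and $H_F$ its determinant. $$\boldsymbol\sigma=Q(\nabla F)\,\mathbf S-2\Delta_{\mathbf S}F\,\boldsymbol\kappa(\nabla F),$$ which induces a rational map $\sigma:\mathbb P^3\dashrightarrow\mathbb P^3$ ($\sigma(m)$ is the orthogonal symmetric of $S$ with respect to the tangent plane to $\mathcal Z$ at $m$). The reflected line $\mathcal R_m$ is the line $(m\,\sigma(m))$. Tangency of $\mathcal R_m$ to $\psi(\mathcal Z)$ at $\psi(m)$ means: there is a nonzero linear form $A\in\mathbf W^\vee$ with $A(\mathbf m)=0$, $A(\boldsymbol\sigma(\mathbf m))=0$ and $A(D\boldsymbol\psi(\mathbf m)\cdot v)=0$ for every $v\in\mathbf W$ with $DF(\mathbf m)\cdot v=0$. *)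

theory Defs
  imports
    "HOL-Analysis.Analysis"
    "HOL-Library.Poly_Mapping"
    "HOL-Computational_Algebra.Polynomial"
begin

section \<open>Homogeneous coordinates and polynomials\<close>

text \<open>
  The components \<open>1, 2, 3, 4\<close> are the coordinates \<open>x, y, z, t\<close> (in the index type
  \<open>4\<close> the numeral \<open>4\<close> is the same element as \<open>0\<close>).
\<close>

type_synonym W = "complex ^ 4"

type_synonym SymW = "(4 \<Rightarrow>\<^sub>0 nat) \<Rightarrow>\<^sub>0 complex"

definition Cst :: "complex \<Rightarrow> SymW" where
  "Cst c = Poly_Mapping.single 0 c"

definition Var :: "4 \<Rightarrow> SymW" where
  "Var i = Poly_Mapping.single (Poly_Mapping.single i 1) 1"

definition peval :: "SymW \<Rightarrow> W \<Rightarrow> complex" where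
  "peval p m = (\<Sum>e\<in>Poly_Mapping.keys p.
      Poly_Mapping.lookup p e * (\<Prod>i\<in>UNIV. (m $ i) ^ Poly_Mapping.lookup e i))"

definition pdiff :: "4 \<Rightarrow> SymW \<Rightarrow> SymW" where
  "pdiff i p = (\<Sum>e\<in>Poly_Mapping.keys p.
      Poly_Mapping.single (e - Poly_Mapping.single i 1)
        (of_nat (Poly_Mapping.lookup e i) * Poly_Mapping.lookup p e))"

definition homogeneous_of_degree :: "nat \<Rightarrow> SymW \<Rightarrow> bool" where
  "homogeneous_of_degree d p \<longleftrightarrow>
     (\<forall>e\<in>Poly_Mapping.keys p. (\<Sum>i\<in>UNIV. Poly_Mapping.lookup e i) = d)"

text \<open>Points of \<open>P(W)\<close> are the lines through the origin.\<close>

definition pt :: "W \<Rightarrow> W set" where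
  "pt m = vec.span {m}"

definition V :: "SymW \<Rightarrow> W set set" where
  "V p = {pt m | m. m \<noteq> 0 \<and> peval p m = 0}"

definition affine_cone :: "SymW \<Rightarrow> W set" where
  "affine_cone p = {m. peval p m = 0}"


section \<open>The map \<open>\<sigma>\<close> and the quadratic relation\<close>

definition Q :: "'a::comm_ring_1 ^ 4 \<Rightarrow> 'a" where
  "Q v = (v $ 1)\<^sup>2 + (v $ 2)\<^sup>2 + (v $ 3)\<^sup>2"

definition kappa :: "'a::comm_ring_1 ^ 4 \<Rightarrow> 'a ^ 4" where
  "kappa v = vector [v $ 1, v $ 2, v $ 3, 0]"

definition cvec :: "W \<Rightarrow> SymW ^ 4" where
  "cvec S = (\<chi> i. Cst (S $ i))"

definition grad :: "SymW \<Rightarrow> SymW ^ 4" where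
  "grad F = (\<chi> i. pdiff i F)"

definition Delta :: "W \<Rightarrow> SymW \<Rightarrow> SymW" where
  "Delta S F = (\<Sum>i\<in>UNIV. Cst (S $ i) * pdiff i F)"

definition sigma :: "SymW \<Rightarrow> W \<Rightarrow> SymW ^ 4" where
  "sigma F S = Q (grad F) *s cvec S - (2 * Delta S F) *s kappa (grad F)"

definition NS :: "W \<Rightarrow> SymW" where
  "NS S = (Var 1 * Cst (S $ 4) - Cst (S $ 1) * Var 4)\<^sup>2
        + (Var 2 * Cst (S $ 4) - Cst (S $ 2) * Var 4)\<^sup>2
        + (Var 3 * Cst (S $ 4) - Cst (S $ 3) * Var 4)\<^sup>2"

definition Hess_matrix :: "SymW \<Rightarrow> SymW ^ 4 ^ 4" where
  "Hess_matrix F = (\<chi> i j. pdiff i (pdiff j F))"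

definition Hess :: "SymW \<Rightarrow> SymW ^ 4 \<Rightarrow> SymW ^ 4 \<Rightarrow> SymW" where
  "Hess F u v = (\<Sum>i\<in>UNIV. \<Sum>j\<in>UNIV. Hess_matrix F $ i $ j * u $ i * v $ j)"

definition alpha :: "SymW \<Rightarrow> W \<Rightarrow> SymW" where
  "alpha F S = Delta S F"

definition beta :: "SymW \<Rightarrow> W \<Rightarrow> SymW" where
  "beta F S = - 2 * (Hess F (cvec S) (sigma F S)
      + (Delta S F)\<^sup>2 * (pdiff 1 (pdiff 1 F) + pdiff 2 (pdiff 2 F) + pdiff 3 (pdiff 3 F)))"

definition gamma :: "nat \<Rightarrow> SymW \<Rightarrow> W \<Rightarrow> SymW" where
  "gamma d F S = - (Cst (4 / (of_nat d - 1)\<^sup>2) * Delta S F * NS S * det (Hess_matrix F))"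

definition sigma_at :: "SymW \<Rightarrow> W \<Rightarrow> W \<Rightarrow> W" where
  "sigma_at F S m = (\<chi> i. peval (sigma F S $ i) m)"


section \<open>Integral extensions and evaluation of their elements\<close>

definition ring_homomorphism :: "('a::comm_ring_1 \<Rightarrow> 'b::comm_ring_1) \<Rightarrow> bool" where
  "ring_homomorphism h \<longleftrightarrow> h 0 = 0 \<and> h 1 = 1 \<and>
     (\<forall>x y. h (x + y) = h x + h y) \<and> (\<forall>x y. h (x * y) = h x * h y)"

definition integral_extension :: "('a::comm_ring_1 \<Rightarrow> 'b::comm_ring_1) \<Rightarrow> bool" where
  "integral_extension \<iota> \<longleftrightarrow> ring_homomorphism \<iota> \<and> inj \<iota> \<and>
     (\<forall>b. \<exists>p :: 'b poly. lead_coeff p = 1 \<and> (\<forall>k. coeff p k \<in> range \<iota>) \<and> poly p b = 0)"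

text \<open>
  The elements of an integral extension of the polynomial ring are multivalued functions on
  \<open>W\<close>.  Giving them values means choosing, for every \<open>m\<close>, a complex point of the extension
  lying over \<open>m\<close>.  No continuity in \<open>m\<close> is built into this choice.
\<close>

definition evaluation_over :: "(SymW \<Rightarrow> 'b::comm_ring_1) \<Rightarrow> (W \<Rightarrow> 'b \<Rightarrow> complex) \<Rightarrow> bool" where
  "evaluation_over \<iota> ev \<longleftrightarrow>
     (\<forall>m. ring_homomorphism (ev m) \<and> (\<forall>f. ev m (\<iota> f) = peval f m))"


section \<open>Tangency of the reflected line\<close>

text \<open>
  The derivative of \<open>\<Psi>\<close> is taken along the affine cone over the surface.  At a smooth point of
  the cone it is uniquely determined on the tangent vectors \<open>v\<close>, which are the only ones used.
\<close>

definition reflected_line_tangent :: "SymW \<Rightarrow> W \<Rightarrow> (W \<Rightarrow> W) \<Rightarrow> W \<Rightarrow> bool" where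
  "reflected_line_tangent F S \<Psi> m \<longleftrightarrow>
     \<Psi> differentiable (at m within affine_cone F) \<and>
     (\<forall>D. (\<Psi> has_derivative D) (at m within affine_cone F) \<longrightarrow>
        (\<exists>A :: W \<Rightarrow> complex. Vector_Spaces.linear (*s) (*) A \<and> A \<noteq> (\<lambda>_. 0) \<and>
           A m = 0 \<and> A (sigma_at F S m) = 0 \<and>
           (\<forall>v. (\<Sum>i\<in>UNIV. peval (pdiff i F) m * v $ i) = 0 \<longrightarrow> A (D v) = 0)))"

end

(*
  A linear form A that kills m and sigma(m) satisfies A(D Psi v) = l0 A(v) + l1 A(D sigma v), since
  the derivatives of l0 and l1 multiply m and sigma(m); only the values of l0 and l1 at m matter.
  As t(m) is not 0, projecting from m onto the plane t = 0 turns the search for A into linear algebra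
  in C^3.  Let g be the spatial part of the gradient, s the image of S and B the spatial block of the
  Hessian.  Then sigma(m) becomes r = (g.g) s - 2 (g.s) g, and for v orthogonal to g the vector
  D sigma v becomes, modulo r,  L v = 2 ((g.Bv) s - (s.Bv) g - (g.s) Bv).  If u, w span the plane
  orthogonal to g and u x w = k g, then
    det (r, l0 u + l1 L u, l0 w + l1 L w) = - k (g.g) (alpha l0^2 + beta l0 l1 + gamma l1^2),
  where Euler's relations identify the Hessian determinant in gamma:
  t^2 det H = - (d - 1)^2 (g . adj(B) g).  So the quadratic relation gives a form A.
*)
theory Submission
  imports Defs
begin

section \<open>Evaluation, differentiation and homogeneity of polynomials\<close>

lemma peval_eq_sum_superset:
  assumes "finite A" "Poly_Mapping.keys p \<subseteq> A"
  shows "peval p m = (\<Sum>e\<in>A. Poly_Mapping.lookup p e * (\<Prod>i\<in>UNIV. (m $ i) ^ Poly_Mapping.lookup e i))"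
  unfolding peval_def using assms
  by (intro sum.mono_neutral_left) (auto simp: in_keys_iff)

lemma pdiff_eq_sum_superset:
  assumes "finite A" "Poly_Mapping.keys p \<subseteq> A"
  shows "pdiff i p = (\<Sum>e\<in>A. Poly_Mapping.single (e - Poly_Mapping.single i 1)
           (of_nat (Poly_Mapping.lookup e i) * Poly_Mapping.lookup p e))"
  unfolding pdiff_def using assms
  by (intro sum.mono_neutral_left) (auto simp: in_keys_iff)

text \<open>The monomials stay in the support of \<open>p\<close>, with arbitrary coefficients; this
  is how a homogeneity hypothesis on \<open>p\<close> reaches the case
  \<open>single\<close>.\<close>

lemma polynomial_induct [case_names zero single add]:
  fixes p :: "('a \<Rightarrow>\<^sub>0 nat) \<Rightarrow>\<^sub>0 'b::comm_monoid_add"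
  assumes "P 0" and "\<And>e c. e \<in> Poly_Mapping.keys p \<Longrightarrow> P (Poly_Mapping.single e c)"
    and "\<And>q r. P q \<Longrightarrow> P r \<Longrightarrow> P (q + r)"
  shows "P p"
proof -
  have *: "P (\<Sum>e\<in>A. Poly_Mapping.single e (Poly_Mapping.lookup p e))"
    if "finite A" "A \<subseteq> Poly_Mapping.keys p" for A
    using that by (induction A rule: finite_induct) (auto intro: assms)
  have "p = (\<Sum>e\<in>Poly_Mapping.keys p. Poly_Mapping.single e (Poly_Mapping.lookup p e))"
    by (rule poly_mapping_eqI)
      (simp add: lookup_sum lookup_single when_def in_keys_iff sum.delta)
  then show ?thesis using *[of "Poly_Mapping.keys p"] by simp
qed

lemma peval_0 [simp]: "peval 0 m = 0"
  by (simp add: peval_def)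

lemma peval_single:
  "peval (Poly_Mapping.single e c) m = c * (\<Prod>i\<in>UNIV. (m $ i) ^ Poly_Mapping.lookup e i)"
  by (subst peval_eq_sum_superset[of "{e}"]) auto

lemma peval_add [simp]: "peval (p + q) m = peval p m + peval q m"
proof -
  let ?A = "Poly_Mapping.keys p \<union> Poly_Mapping.keys q"
  have "Poly_Mapping.keys (p + q) \<subseteq> ?A" by (rule keys_add)
  then show ?thesis
    by (simp add: peval_eq_sum_superset[of ?A] lookup_add algebra_simps sum.distrib)
qed

lemma peval_mult [simp]: "peval (p * q) m = peval p m * peval q m"
proof (induction p rule: polynomial_induct)
  case (single e c)
  show ?case
    by (induction q rule: polynomial_induct)
      (auto simp: mult_single peval_single lookup_add power_add prod.distrib distrib_left)
qed (auto simp: distrib_right)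

lemma peval_uminus [simp]: "peval (- p) m = - peval p m"
  using peval_add[of p "- p" m] by (simp add: eq_neg_iff_add_eq_0 add.commute)

lemma peval_diff [simp]: "peval (p - q) m = peval p m - peval q m"
  using peval_add[of p "- q" m] by simp

lemma peval_Cst [simp]: "peval (Cst c) m = c"
  by (simp add: Cst_def peval_single)

lemma peval_1 [simp]: "peval 1 m = 1"
  using peval_Cst[of 1 m] by (simp add: Cst_def)

lemma peval_of_nat [simp]: "peval (of_nat n) m = of_nat n"
  by (induction n) auto

lemma peval_numeral [simp]: "peval (numeral n) m = numeral n"
  using peval_of_nat[of "numeral n" m] by simp

lemma peval_of_int [simp]: "peval (of_int n) m = of_int n"
  by (cases n) auto

lemma peval_Var [simp]: "peval (Var i) m = m $ i"
proof -
  have "(m $ j) ^ Poly_Mapping.lookup (Poly_Mapping.single i 1) j = (if j = i then m $ i else 1)" for j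
    by (simp add: lookup_single when_def)
  then show ?thesis by (simp add: Var_def peval_single)
qed

lemma peval_power [simp]: "peval (p ^ n) m = peval p m ^ n"
  by (induction n) auto

lemma peval_sum [simp]: "peval (\<Sum>x\<in>A. f x) m = (\<Sum>x\<in>A. peval (f x) m)"
  by (induction A rule: infinite_finite_induct) auto

lemma peval_prod [simp]: "peval (\<Prod>x\<in>A. f x) m = (\<Prod>x\<in>A. peval (f x) m)"
  by (induction A rule: infinite_finite_induct) auto

lemma peval_det: "peval (det M) m = det (\<chi> i j. peval (M $ i $ j) m)"
  by (simp add: det_def)

section \<open>Formal partial derivatives\<close>

lemma pdiff_0 [simp]: "pdiff i 0 = 0"
  by (simp add: pdiff_def)

lemma pdiff_single:
  "pdiff i (Poly_Mapping.single e c) =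
     Poly_Mapping.single (e - Poly_Mapping.single i 1) (of_nat (Poly_Mapping.lookup e i) * c)"
  by (subst pdiff_eq_sum_superset[of "{e}"]) auto

lemma pdiff_add: "pdiff i (p + q) = pdiff i p + pdiff i q"
proof -
  let ?A = "Poly_Mapping.keys p \<union> Poly_Mapping.keys q"
  have "Poly_Mapping.keys (p + q) \<subseteq> ?A" by (rule keys_add)
  then show ?thesis
    by (simp add: pdiff_eq_sum_superset[of ?A] lookup_add algebra_simps sum.distrib single_add)
qed

text \<open>Truncated subtraction of exponents commutes, and for distinct indices lowering one
  exponent does not change the factor that the other one contributes.\<close>

lemma pdiff_commute: "pdiff i (pdiff j p) = pdiff j (pdiff i p)"
proof (cases "i = j")
  case False
  show ?thesis
  proof (induction p rule: polynomial_induct)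
    case (single e c)
    have "e - Poly_Mapping.single j 1 - Poly_Mapping.single i 1 =
          e - Poly_Mapping.single i 1 - Poly_Mapping.single j (1::nat)"
      by (simp add: diff_diff_eq add.commute)
    then show ?case
      using False by (simp add: pdiff_single lookup_minus lookup_single ac_simps)
  qed (auto simp: pdiff_add)
qed simp

lemma peval_pdiff_single:
  "peval (pdiff i (Poly_Mapping.single e c)) m =
     c * (of_nat (Poly_Mapping.lookup e i) * (m $ i) ^ (Poly_Mapping.lookup e i - 1)
       * (\<Prod>j\<in>UNIV - {i}. (m $ j) ^ Poly_Mapping.lookup e j))"
proof -
  have "(\<Prod>j\<in>UNIV. (m $ j) ^ Poly_Mapping.lookup (e - Poly_Mapping.single i 1) j) =
        (m $ i) ^ (Poly_Mapping.lookup e i - 1)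
         * (\<Prod>j\<in>UNIV - {i}. (m $ j) ^ Poly_Mapping.lookup e j)"
    by (subst prod.remove[of _ i]) (auto simp: lookup_minus lookup_single intro!: prod.cong)
  then show ?thesis by (simp add: pdiff_single peval_single)
qed

lemma has_derivative_peval:
  "(peval p has_derivative (\<lambda>v. \<Sum>i\<in>UNIV. peval (pdiff i p) m * v $ i)) (at m within X)"
proof (induction p rule: polynomial_induct)
  case zero
  have "peval 0 = (\<lambda>_. 0)" by (rule ext) simp
  then show ?case by simp
next
  case (single e c)
  have eq: "peval (Poly_Mapping.single e c) =
      (\<lambda>m. c * (\<Prod>i\<in>UNIV. (m $ i) ^ Poly_Mapping.lookup e i))"
    by (rule ext) (simp add: peval_single)
  have "((\<lambda>x. (x $ i) ^ k) has_derivative (\<lambda>v. of_nat k * v $ i * (m $ i) ^ (k - 1))) (at m within X)"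
    for i k
    by (intro has_derivative_power bounded_linear_imp_has_derivative bounded_linear_vec_nth)
  from has_derivative_mult_right[OF has_derivative_prod, OF this]
  have "((\<lambda>x. c * (\<Prod>i\<in>UNIV. (x $ i) ^ Poly_Mapping.lookup e i)) has_derivative
      (\<lambda>v. c * (\<Sum>i\<in>UNIV. of_nat (Poly_Mapping.lookup e i) * v $ i
        * (m $ i) ^ (Poly_Mapping.lookup e i - 1)
        * (\<Prod>j\<in>UNIV - {i}. (m $ j) ^ Poly_Mapping.lookup e j)))) (at m within X)" .
  then show ?case
    unfolding eq peval_pdiff_single by (simp add: sum_distrib_left ac_simps)
next
  case (add q r)
  have eq: "peval (q + r) = (\<lambda>m. peval q m + peval r m)" by (rule ext) simp
  show ?case unfolding eq
    using has_derivative_add[OF add.IH] by (simp add: pdiff_add distrib_right sum.distrib)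
qed

section \<open>Homogeneous polynomials\<close>

lemma homogeneous_of_degreeI:
  "(\<And>e. e \<in> Poly_Mapping.keys p \<Longrightarrow> (\<Sum>i\<in>UNIV. Poly_Mapping.lookup e i) = n)
    \<Longrightarrow> homogeneous_of_degree n p"
  by (auto simp: homogeneous_of_degree_def)

lemma homogeneous_0 [simp]: "homogeneous_of_degree n 0"
  by (simp add: homogeneous_of_degree_def)

lemma homogeneous_Cst: "homogeneous_of_degree 0 (Cst c)"
  by (auto simp: homogeneous_of_degree_def Cst_def split: if_splits)

lemma homogeneous_1: "homogeneous_of_degree 0 1"
  using homogeneous_Cst[of 1] by (simp add: Cst_def)

lemma homogeneous_Var: "homogeneous_of_degree 1 (Var i)"
  by (auto simp: homogeneous_of_degree_def Var_def lookup_single when_def)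

lemma homogeneous_add:
  "homogeneous_of_degree n p \<Longrightarrow> homogeneous_of_degree n q \<Longrightarrow> homogeneous_of_degree n (p + q)"
  using keys_add[of p q] by (auto simp: homogeneous_of_degree_def)

lemma homogeneous_uminus: "homogeneous_of_degree n p \<Longrightarrow> homogeneous_of_degree n (- p)"
  by (auto simp: homogeneous_of_degree_def in_keys_iff)

lemma homogeneous_diff:
  "homogeneous_of_degree n p \<Longrightarrow> homogeneous_of_degree n q \<Longrightarrow> homogeneous_of_degree n (p - q)"
  using homogeneous_add[of n p "- q"] homogeneous_uminus[of n q] by simp

lemma homogeneous_mult:
  assumes "homogeneous_of_degree n p" "homogeneous_of_degree k q"
  shows "homogeneous_of_degree (n + k) (p * q)"
  using keys_mult[of p q] assms
  by (fastforce simp: homogeneous_of_degree_def lookup_add sum.distrib)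

lemma homogeneous_power:
  "homogeneous_of_degree n p \<Longrightarrow> homogeneous_of_degree (k * n) (p ^ k)"
  by (induction k) (auto intro: homogeneous_1 homogeneous_mult)

lemma homogeneous_sum:
  "(\<And>x. x \<in> A \<Longrightarrow> homogeneous_of_degree n (f x)) \<Longrightarrow> homogeneous_of_degree n (\<Sum>x\<in>A. f x)"
  by (induction A rule: infinite_finite_induct) (auto intro: homogeneous_add)

lemma homogeneous_prod:
  "(\<And>x. x \<in> A \<Longrightarrow> homogeneous_of_degree n (f x)) \<Longrightarrow>
    homogeneous_of_degree (card A * n) (\<Prod>x\<in>A. f x)"
  by (induction A rule: infinite_finite_induct) (auto intro: homogeneous_1 homogeneous_mult)

lemma homogeneous_of_nat: "homogeneous_of_degree 0 (of_nat k)"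
  by (induction k) (auto intro: homogeneous_1 homogeneous_add)

lemma homogeneous_of_int: "homogeneous_of_degree 0 (of_int k)"
proof (cases k)
  case (neg n)
  then show ?thesis using homogeneous_uminus[OF homogeneous_of_nat[of "Suc n"]] by simp
qed (simp add: homogeneous_of_nat)

lemma homogeneous_det:
  fixes M :: "SymW ^ 'n ^ 'n"
  assumes "\<And>i j. homogeneous_of_degree n (M $ i $ j)"
  shows "homogeneous_of_degree (CARD('n) * n) (det M)"
  unfolding det_def
proof (rule homogeneous_sum)
  fix \<pi>
  show "homogeneous_of_degree (CARD('n) * n) (of_int (sign \<pi>) * (\<Prod>i\<in>UNIV. M $ i $ \<pi> i))"
    using homogeneous_mult[OF homogeneous_of_int homogeneous_prod[of UNIV n "\<lambda>i. M $ i $ \<pi> i"]] assms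
    by simp
qed

text \<open>The truncated \<open>n - 1\<close> does no harm at \<open>n = 0\<close>: a monomial that
  survives differentiation had a positive exponent at \<open>i\<close>.\<close>

lemma homogeneous_pdiff:
  assumes "homogeneous_of_degree n p"
  shows "homogeneous_of_degree (n - 1) (pdiff i p)"
proof (induction p rule: polynomial_induct)
  case (single e c)
  show ?case
  proof (rule homogeneous_of_degreeI)
    fix e' assume "e' \<in> Poly_Mapping.keys (pdiff i (Poly_Mapping.single e c))"
    then have e': "e' = e - Poly_Mapping.single i 1" and nz: "Poly_Mapping.lookup e i \<noteq> 0"
      by (auto simp: pdiff_single split: if_splits)
    have "(\<Sum>j\<in>UNIV. Poly_Mapping.lookup e j) = n"
      using single assms by (simp add: homogeneous_of_degree_def)
    then show "(\<Sum>j\<in>UNIV. Poly_Mapping.lookup e' j) = n - 1"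
      using nz by (subst (asm) sum.remove[of _ i], simp, simp, subst sum.remove[of _ i])
        (auto simp: e' lookup_minus lookup_single)
  qed
qed (auto simp: pdiff_add intro: homogeneous_add)

text \<open>On a monomial, differentiating in direction \<open>i\<close> and multiplying by the same
  coordinate gives back the monomial times its exponent at \<open>i\<close>; the exponents add up to
  \<open>n\<close>.\<close>

lemma euler_homogeneous:
  assumes "homogeneous_of_degree n p"
  shows "(\<Sum>i\<in>UNIV. peval (pdiff i p) m * m $ i) = of_nat n * peval p m"
proof (induction p rule: polynomial_induct)
  case (single e c)
  have deg: "(\<Sum>j\<in>UNIV. Poly_Mapping.lookup e j) = n"
    using single assms by (simp add: homogeneous_of_degree_def)
  have "peval (pdiff i (Poly_Mapping.single e c)) m * m $ i =
      of_nat (Poly_Mapping.lookup e i) * peval (Poly_Mapping.single e c) m" for i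
  proof (cases "Poly_Mapping.lookup e i")
    case (Suc k)
    then show ?thesis
      unfolding peval_pdiff_single peval_single
      by (subst prod.remove[of _ i]) auto
  qed (simp add: peval_pdiff_single)
  then show ?case by (simp add: deg flip: sum_distrib_right of_nat_sum)
qed (auto simp: pdiff_add distrib_right distrib_left sum.distrib)

lemma peval_scale:
  assumes "homogeneous_of_degree n p"
  shows "peval p (c *s m) = c ^ n * peval p m"
  unfolding peval_def sum_distrib_left
proof (rule sum.cong)
  fix e assume "e \<in> Poly_Mapping.keys p"
  then have "(\<Sum>j\<in>UNIV. Poly_Mapping.lookup e j) = n"
    using assms by (simp add: homogeneous_of_degree_def)
  then have "(\<Prod>i\<in>UNIV. c ^ Poly_Mapping.lookup e i) = c ^ n"
    by (simp flip: power_sum)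
  then show "Poly_Mapping.lookup p e * (\<Prod>i\<in>UNIV. (c *s m) $ i ^ Poly_Mapping.lookup e i) =
      c ^ n * (Poly_Mapping.lookup p e * (\<Prod>i\<in>UNIV. m $ i ^ Poly_Mapping.lookup e i))"
    by (simp add: power_mult_distrib prod.distrib)
qed simp

section \<open>The determinant identity in three-space\<close>

text \<open>Bilinear, without conjugation: from dimension 2 on there are nonzero isotropic vectors,
  so nonvanishing of \<open>dot g g\<close> is more than nonvanishing of \<open>g\<close>.\<close>

definition dot :: "complex ^ 'n \<Rightarrow> complex ^ 'n \<Rightarrow> complex" where
  "dot a b = (\<Sum>i\<in>UNIV. a $ i * b $ i)"

definition cross :: "complex ^ 3 \<Rightarrow> complex ^ 3 \<Rightarrow> complex ^ 3" where
  "cross a b = vector [a $ 2 * b $ 3 - a $ 3 * b $ 2, a $ 3 * b $ 1 - a $ 1 * b $ 3,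
     a $ 1 * b $ 2 - a $ 2 * b $ 1]"

text \<open>The cofactor matrix of \<open>B\<close> applied to \<open>n\<close>.\<close>

definition cof :: "complex ^ 3 ^ 3 \<Rightarrow> complex ^ 3 \<Rightarrow> complex ^ 3" where
  "cof B n = vector [dot (cross (B $ 2) (B $ 3)) n, dot (cross (B $ 3) (B $ 1)) n,
     dot (cross (B $ 1) (B $ 2)) n]"

lemma det_4:
  "det (A::'a::comm_ring_1^4^4) =
    A $ 4 $ 4 * (A$1$1 * A$2$2 * A$3$3 + A$1$2 * A$2$3 * A$3$1 + A$1$3 * A$2$1 * A$3$2
      - A$1$1 * A$2$3 * A$3$2 - A$1$2 * A$2$1 * A$3$3 - A$1$3 * A$2$2 * A$3$1)
  - A $ 4 $ 3 * (A$1$1 * A$2$2 * A$3$4 + A$1$2 * A$2$4 * A$3$1 + A$1$4 * A$2$1 * A$3$2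
      - A$1$1 * A$2$4 * A$3$2 - A$1$2 * A$2$1 * A$3$4 - A$1$4 * A$2$2 * A$3$1)
  + A $ 4 $ 2 * (A$1$1 * A$2$3 * A$3$4 + A$1$3 * A$2$4 * A$3$1 + A$1$4 * A$2$1 * A$3$3
      - A$1$1 * A$2$4 * A$3$3 - A$1$3 * A$2$1 * A$3$4 - A$1$4 * A$2$3 * A$3$1)
  - A $ 4 $ 1 * (A$1$2 * A$2$3 * A$3$4 + A$1$3 * A$2$4 * A$3$2 + A$1$4 * A$2$2 * A$3$3
      - A$1$2 * A$2$4 * A$3$3 - A$1$3 * A$2$2 * A$3$4 - A$1$4 * A$2$3 * A$3$2)"
proof -
  have f1: "finite {2::4, 3, 4}" "1 \<notin> {2::4, 3, 4}" by auto
  have f2: "finite {3::4, 4}" "2 \<notin> {3::4, 4}" by auto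
  have f3: "finite {4::4}" "3 \<notin> {4::4}" by auto
  show ?thesis
    unfolding det_def UNIV_4 sum_over_permutations_insert[OF f1] sum_over_permutations_insert[OF f2]
      sum_over_permutations_insert[OF f3] permutes_sing
    by (simp add: sign_swap_id permutation_swap_id sign_compose sign_id permutation_compose
          Transposition.transpose_def algebra_simps)
qed

lemmas cartesian3_defs = dot_def cross_def cof_def matrix_vector_mult_def sum_3 vector_3 trace_def

lemma symmetric_nth:
  assumes "transpose B = B"
  shows "B $ i $ j = B $ j $ i"
proof -
  have "B $ i $ j = transpose B $ i $ j" using assms by simp
  then show ?thesis by (simp add: transpose_def)
qed

text \<open>This brings the cofactor matrix, and through it the Hessian determinant, into the
  coefficient of \<open>l1\<^sup>2\<close>.\<close>

lemma cross_matrix_vector_mult: "cross (B *v u) (B *v w) = cof B (cross u w)"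
  by (simp add: vec_eq_iff forall_3 cartesian3_defs algebra_simps)

text \<open>The triple product is the determinant of the matrix with rows \<open>a\<close>,
  \<open>b\<close>, \<open>c\<close>; a kernel vector later supplies the coefficients of the tangent
  form.\<close>

lemma exists_orthogonal_of_triple_zero:
  assumes "dot a (cross b c) = 0"
  obtains x where "x \<noteq> 0" "dot x a = 0" "dot x b = 0" "dot x c = 0"
proof -
  let ?M = "vector [a, b, c] :: complex ^ 3 ^ 3"
  have "det ?M = 0"
    using assms by (simp add: det_3 cartesian3_defs algebra_simps)
  then have "\<not> invertible ?M" by (simp add: invertible_det_nz)
  then obtain x where "x \<noteq> 0" "?M *v x = 0"
    by (metis invertible_left_inverse matrix_left_invertible_ker)
  then show thesis
    by (intro that) (auto simp: vec_eq_iff forall_3 cartesian3_defs mult.commute)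
qed

text \<open>An isotropic \<open>g\<close> lies in its own orthogonal plane, so no orthogonal
  splitting is available. The basis is written down from a nonzero coordinate of \<open>g\<close>,
  which also serves as \<open>k\<close>.\<close>

lemma orthogonal_plane_basis:
  assumes "g \<noteq> 0"
  obtains u w k where "dot g u = 0" "dot g w = 0" "cross u w = k *s g"
    "\<And>v. dot g v = 0 \<Longrightarrow> \<exists>a b. v = a *s u + b *s w"
proof -
  have "g $ 1 \<noteq> 0 \<or> g $ 2 \<noteq> 0 \<or> g $ 3 \<noteq> 0"
    using assms by (auto simp: vec_eq_iff forall_3)
  then show thesis
  proof (elim disjE)
    assume nz: "g $ 1 \<noteq> 0"
    show thesis
    proof (rule that[of "vector [- g $ 2, g $ 1, 0]" "vector [- g $ 3, 0, g $ 1]" "g $ 1"])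
      fix v assume "dot g v = 0"
      with nz have "v = (v $ 2 / g $ 1) *s vector [- g $ 2, g $ 1, 0]
          + (v $ 3 / g $ 1) *s vector [- g $ 3, 0, g $ 1]"
        by (simp add: vec_eq_iff forall_3 cartesian3_defs field_simps) algebra
      then show "\<exists>a b. v = a *s vector [- g $ 2, g $ 1, 0] + b *s vector [- g $ 3, 0, g $ 1]"
        by blast
    qed (simp_all add: vec_eq_iff forall_3 cartesian3_defs)
  next
    assume nz: "g $ 2 \<noteq> 0"
    show thesis
    proof (rule that[of "vector [0, - g $ 3, g $ 2]" "vector [g $ 2, - g $ 1, 0]" "g $ 2"])
      fix v assume "dot g v = 0"
      with nz have "v = (v $ 3 / g $ 2) *s vector [0, - g $ 3, g $ 2]
          + (v $ 1 / g $ 2) *s vector [g $ 2, - g $ 1, 0]"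
        by (simp add: vec_eq_iff forall_3 cartesian3_defs field_simps) algebra
      then show "\<exists>a b. v = a *s vector [0, - g $ 3, g $ 2] + b *s vector [g $ 2, - g $ 1, 0]"
        by blast
    qed (simp_all add: vec_eq_iff forall_3 cartesian3_defs)
  next
    assume nz: "g $ 3 \<noteq> 0"
    show thesis
    proof (rule that[of "vector [g $ 3, 0, - g $ 1]" "vector [0, g $ 3, - g $ 2]" "g $ 3"])
      fix v assume "dot g v = 0"
      with nz have "v = (v $ 1 / g $ 3) *s vector [g $ 3, 0, - g $ 1]
          + (v $ 2 / g $ 3) *s vector [0, g $ 3, - g $ 2]"
        by (simp add: vec_eq_iff forall_3 cartesian3_defs field_simps) algebra
      then show "\<exists>a b. v = a *s vector [g $ 3, 0, - g $ 1] + b *s vector [0, g $ 3, - g $ 2]"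
        by blast
    qed (simp_all add: vec_eq_iff forall_3 cartesian3_defs)
  qed
qed

section \<open>Triple products of a reflected vector and its derivatives\<close>

definition reflect :: "complex ^ 3 \<Rightarrow> complex ^ 3 \<Rightarrow> complex ^ 3" where
  "reflect g s = dot g g *s s - (2 * dot g s) *s g"

text \<open>The derivative of \<open>reflect g s\<close> with respect to \<open>g\<close> in the
  direction \<open>h\<close>.\<close>

definition dreflect :: "complex ^ 3 \<Rightarrow> complex ^ 3 \<Rightarrow> complex ^ 3 \<Rightarrow> complex ^ 3" where
  "dreflect g s h = 2 *s (dot g h *s s - dot s h *s g - dot g s *s h)"

text \<open>The linear map \<open>dreflect g s\<close> sends \<open>g\<close> to twice
  \<open>reflect g s\<close>, so its adjugate sends \<open>reflect g s\<close> to half its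
  determinant times \<open>g\<close>. That determinant is
  \<open>- 8 * dot g g * dot g s * dot s s\<close>.\<close>

lemma triple_reflect_dreflect_dreflect:
  "dot (reflect g s) (cross (dreflect g s a) (dreflect g s b)) =
     - 4 * dot g g * dot g s * dot s s * dot g (cross a b)"
  unfolding reflect_def dreflect_def cartesian3_defs vector_smult_component vector_add_component vector_minus_component
  by algebra

lemma triple_reflect_dreflect_mixed:
  assumes "transpose B = B" and "cross u w = k *s g"
  shows "dot (reflect g s) (cross u (dreflect g s (B *v w))) + dot (reflect g s) (cross (dreflect g s (B *v u)) w)
     = 2 * k * dot g g * (dot s (B *v reflect g s) + (dot g s)\<^sup>2 * trace B)"
proof -
  have sym: "B $ 2 $ 1 = B $ 1 $ 2" "B $ 3 $ 1 = B $ 1 $ 3" "B $ 3 $ 2 = B $ 2 $ 3"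
    using symmetric_nth[OF assms(1)] by blast+
  let ?r = "reflect g s" and ?n = "cross u w"
  have adj: "dot a (B *v b) = dot (B *v a) b" for a b
    by (simp add: cartesian3_defs sym algebra_simps)
  \<comment> \<open>The Binet-Cauchy identity for \<open>cross p (cross a r)\<close> against
    \<open>cross u w\<close>, with the double cross product expanded.\<close>
  have binet: "dot p w * dot r (cross u a) + dot p u * dot r (cross a w)
      = dot r ?n * dot a p - dot r p * dot a ?n" for p r a
    by (simp add: cartesian3_defs algebra_simps)
  \<comment> \<open>The part of \<open>cross_matrix_vector_mult\<close> that is linear in
    \<open>B\<close> when the matrix there is the identity plus \<open>B\<close>.\<close>
  have tr: "dot r (cross u (B *v w)) + dot r (cross (B *v u) w) = trace B * dot r ?n - dot r (B *v ?n)" for r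
    by (simp add: cartesian3_defs sym algebra_simps)
  have exp: "dot r (cross u (dreflect g s b)) =
      2 * (dot g b * dot r (cross u s) - dot s b * dot r (cross u g) - dot g s * dot r (cross u b))"
    "dot r (cross (dreflect g s b) w) =
      2 * (dot g b * dot r (cross s w) - dot s b * dot r (cross g w) - dot g s * dot r (cross b w))" for r b
    by (simp_all add: dreflect_def cartesian3_defs algebra_simps)
  \<comment> \<open>Symmetry moves \<open>B\<close> from \<open>u\<close> and \<open>w\<close> onto
    \<open>g\<close> and \<open>s\<close>; then \<open>binet\<close> and \<open>tr\<close> eliminate
    \<open>u\<close> and \<open>w\<close> in favour of their cross product, a multiple of
    \<open>g\<close>.\<close>
  have "dot ?r (cross u (dreflect g s (B *v w))) + dot ?r (cross (dreflect g s (B *v u)) w) =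
     2 * (dot ?r ?n * dot s (B *v g) - dot ?r (B *v g) * dot s ?n
        - (dot ?r ?n * dot g (B *v s) - dot ?r (B *v s) * dot g ?n)
        - dot g s * (trace B * dot ?r ?n - dot ?r (B *v ?n)))"
    using binet[of "B *v g" ?r s] binet[of "B *v s" ?r g] tr[of ?r]
    unfolding exp adj[of g u] adj[of g w] adj[of s u] adj[of s w] by algebra
  moreover have "dot a (k *s b) = k * dot a b" "B *v (k *s b) = k *s (B *v b)" for a b
    by (simp_all add: cartesian3_defs vec_eq_iff forall_3 algebra_simps)
  moreover have "dot g (B *v s) = dot s (B *v g)" "dot s (B *v ?r) = dot ?r (B *v s)" "dot s g = dot g s"
    by (simp_all add: cartesian3_defs sym algebra_simps)
  moreover have "dot ?r g = - dot g g * dot g s"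
    by (simp add: reflect_def cartesian3_defs algebra_simps)
  ultimately show ?thesis
    unfolding assms(2) by (simp add: algebra_simps power2_eq_square)
qed

text \<open>Expanding in \<open>l0\<close> and \<open>l1\<close> gives three triple products, each
  with the factor \<open>k * dot g g\<close>; what remains is the quadratic relation written in
  three-space.\<close>

lemma triple_reflect_pencil:
  assumes "transpose B = B" and "cross u w = k *s g" and "dot g u = 0" "dot g w = 0"
  shows "dot (reflect g s) (cross (l0 *s u + l1 *s dreflect g s (B *v u)) (l0 *s w + l1 *s dreflect g s (B *v w)))
     = - k * dot g g * (dot g s * l0\<^sup>2
        - 2 * (dot s (B *v reflect g s) + (dot g s)\<^sup>2 * trace B) * l0 * l1
        + 4 * dot g s * dot s s * dot g (cof B g) * l1\<^sup>2)"
proof -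
  let ?r = "reflect g s" and ?L = "\<lambda>u. dreflect g s (B *v u)"
  have bil: "dot r (cross (l0 *s u + l1 *s a) (l0 *s w + l1 *s b)) =
      l0\<^sup>2 * dot r (cross u w) + l0 * l1 * (dot r (cross u b) + dot r (cross a w))
      + l1\<^sup>2 * dot r (cross a b)" for r a b
    by (simp add: cartesian3_defs algebra_simps power2_eq_square)
  have 1: "dot ?r (cross u w) = - k * dot g g * dot g s"
    unfolding assms(2) reflect_def by (simp add: cartesian3_defs algebra_simps)
  have "dot g (cof B (k *s g)) = k * dot g (cof B g)"
    by (simp add: cartesian3_defs algebra_simps)
  then have 2: "dot ?r (cross (?L u) (?L w)) = - 4 * dot g g * dot g s * dot s s * (k * dot g (cof B g))"
    by (simp add: triple_reflect_dreflect_dreflect cross_matrix_vector_mult assms(2))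
  show ?thesis
    unfolding bil 1 2 triple_reflect_dreflect_mixed[OF assms(1,2)] by (simp add: algebra_simps)
qed

text \<open>For symmetric \<open>B\<close>, applying \<open>cof B\<close> to \<open>B *v m\<close>
  gives \<open>det B\<close> times \<open>m\<close>, which evaluates the mixed and the last term of
  the expanded quadratic form.\<close>

lemma dot_cof_shift:
  assumes "transpose B = B"
  shows "dot (c *s g - B *v m) (cof B (c *s g - B *v m)) =
     c\<^sup>2 * dot g (cof B g) - det B * (2 * c * dot g m - dot m (B *v m))"
proof -
  have sym: "B $ 2 $ 1 = B $ 1 $ 2" "B $ 3 $ 1 = B $ 1 $ 3" "B $ 3 $ 2 = B $ 2 $ 3"
    using symmetric_nth[OF assms] by blast+
  show ?thesis
    by (simp add: cartesian3_defs sym det_3 power2_eq_square algebra_simps)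
qed

text \<open>By \<open>Hm\<close>, the spatial part of the last column of \<open>H\<close>, times
  \<open>m $ 4\<close>, is \<open>c *s g' - B *v m'\<close>. In the expansion of the bordered
  determinant the terms with \<open>det B\<close> then cancel, leaving the cofactor form at
  \<open>g'\<close>.\<close>

lemma det_symmetric_homogeneous:
  fixes H :: "complex ^ 4 ^ 4" and B :: "complex ^ 3 ^ 3" and g' :: "complex ^ 3"
  assumes sym: "transpose H = H" and Hm: "H *v m = c *s g" and gm: "(\<Sum>i\<in>UNIV. g $ i * m $ i) = 0"
  defines "B \<equiv> vector [vector [H$1$1, H$1$2, H$1$3], vector [H$2$1, H$2$2, H$2$3], vector [H$3$1, H$3$2, H$3$3]]"
  defines "g' \<equiv> vector [g $ 1, g $ 2, g $ 3]"
  shows "(m $ 4)\<^sup>2 * det H = - c\<^sup>2 * dot g' (cof B g')"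
proof -
  have s: "H $ 2 $ 1 = H $ 1 $ 2" "H $ 3 $ 1 = H $ 1 $ 3" "H $ 3 $ 2 = H $ 2 $ 3"
    "H $ 4 $ 1 = H $ 1 $ 4" "H $ 4 $ 2 = H $ 2 $ 4" "H $ 4 $ 3 = H $ 3 $ 4"
    using symmetric_nth[OF sym] by blast+
  define m' :: "complex ^ 3" where "m' = vector [m $ 1, m $ 2, m $ 3]"
  define h where "h = c *s g' - B *v m'"
  have Bs: "transpose B = B"
    by (simp add: B_def transpose_def vec_eq_iff forall_3 s)
  have h: "h $ 1 = m $ 4 * H $ 1 $ 4" "h $ 2 = m $ 4 * H $ 2 $ 4" "h $ 3 = m $ 4 * H $ 3 $ 4"
     and H4: "H $ 4 $ 4 * m $ 4 = c * g $ 4 - (H$1$4 * m $ 1 + H$2$4 * m $ 2 + H$3$4 * m $ 3)"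
    using Hm by (simp_all add: h_def g'_def m'_def B_def cartesian3_defs vec_eq_iff forall_4 sum_4 s algebra_simps)
  have "(m $ 4)\<^sup>2 * H $ 4 $ 4 = c * (g $ 4 * m $ 4) - dot h m'"
    using H4 by (simp add: m'_def cartesian3_defs h power2_eq_square) algebra
  also have "g $ 4 * m $ 4 = - dot g' m'"
    using gm by (simp add: sum_4 m'_def g'_def cartesian3_defs) algebra
  finally have H44: "(m $ 4)\<^sup>2 * H $ 4 $ 4 = dot m' (B *v m') - 2 * c * dot g' m'"
    by (simp add: h_def cartesian3_defs algebra_simps)
  have "(m $ 4)\<^sup>2 * det H = ((m $ 4)\<^sup>2 * H $ 4 $ 4) * det B - dot h (cof B h)"
    by (simp add: det_4 det_3 cartesian3_defs h B_def s algebra_simps power2_eq_square)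
  also have "dot h (cof B h) = c\<^sup>2 * dot g' (cof B g') - det B * (2 * c * dot g' m' - dot m' (B *v m'))"
    unfolding h_def by (rule dot_cof_shift[OF Bs])
  finally show ?thesis unfolding H44 by (simp add: algebra_simps)
qed

section \<open>Projection from a point with homogeneous Hessian data\<close>

definition restr :: "W \<Rightarrow> complex ^ 3" where
  "restr x = vector [x $ 1, x $ 2, x $ 3]"

text \<open>If \<open>m $ 4\<close> \<noteq> 0, this is the linear projection onto the plane t = 0
  with kernel the line of \<open>m\<close>; linear forms on three-space pull back to exactly the
  forms that kill \<open>m\<close>.\<close>

definition proj_from :: "W \<Rightarrow> W \<Rightarrow> complex ^ 3" where
  "proj_from m x = restr (x - (x $ 4 / m $ 4) *s m)"

definition block3 :: "complex ^ 4 ^ 4 \<Rightarrow> complex ^ 3 ^ 3" where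
  "block3 H = vector [restr (H $ 1), restr (H $ 2), restr (H $ 3)]"

lemma restr_nth [simp]: "restr x $ 1 = x $ 1" "restr x $ 2 = x $ 2" "restr x $ 3 = x $ 3"
  by (simp_all add: restr_def)

lemma restr_linear:
  "restr (x + y) = restr x + restr y" "restr (x - y) = restr x - restr y" "restr (c *s x) = c *s restr x"
  by (simp_all add: vec_eq_iff forall_3)

lemma proj_from_linear:
  "proj_from m (x + y) = proj_from m x + proj_from m y"
  "proj_from m (x - y) = proj_from m x - proj_from m y"
  "proj_from m (c *s x) = c *s proj_from m x"
  by (simp_all add: proj_from_def restr_linear vec_eq_iff forall_3 diff_divide_distrib add_divide_distrib
      algebra_simps)

lemma proj_from_center: "m $ 4 \<noteq> 0 \<Longrightarrow> proj_from m m = 0"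
  by (simp add: proj_from_def restr_def vec_eq_iff forall_3)

lemma kappa_nth [simp]:
  "kappa v $ 1 = v $ 1" "kappa v $ 2 = v $ 2" "kappa v $ 3 = v $ 3" "kappa v $ 4 = 0"
  by (simp_all add: kappa_def vector_def)

lemma proj_from_kappa: "proj_from m (kappa v) = restr v"
  by (simp add: proj_from_def vec_eq_iff forall_3)

lemma block3_nth:
  "block3 H $ 1 = restr (H $ 1)" "block3 H $ 2 = restr (H $ 2)" "block3 H $ 3 = restr (H $ 3)"
  by (simp_all add: block3_def)

lemma dot_linear:
  "dot a (x + y) = dot a x + dot a y" "dot a (x - y) = dot a x - dot a y" "dot a (c *s x) = c * dot a x"
  "dot (x + y) a = dot x a + dot y a" "dot (x - y) a = dot x a - dot y a" "dot (c *s x) a = c * dot x a"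
  "dot a 0 = 0"
  by (simp_all add: dot_def algebra_simps sum.distrib sum_subtractf sum_distrib_left)

lemma dot_commute: "dot a b = dot b a"
  by (simp add: dot_def mult.commute)

text \<open>The data of the surface at one point: \<open>g\<close> and \<open>H\<close> stand for
  the gradient and the Hessian matrix of F, and \<open>c\<close> for d - 1. \<open>Hm\<close> and
  \<open>gm\<close> are Euler's relations for the gradient and for F at a zero.\<close>

locale homogeneous_hessian =
  fixes g m S :: W and H :: "complex ^ 4 ^ 4" and c :: complex
  assumes sym: "transpose H = H" and Hm: "H *v m = c *s g" and gm: "dot g m = 0"
    and m4: "m $ 4 \<noteq> 0" and c: "c \<noteq> 0" and Qg: "Q g \<noteq> 0"
begin

abbreviation "g' \<equiv> restr g"
abbreviation "P \<equiv> proj_from m"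
abbreviation "s \<equiv> P S"
abbreviation "B \<equiv> block3 H"

definition sig :: W where
  "sig = Q g *s S - (2 * dot S g) *s kappa g"

text \<open>The derivative of sigma in the direction \<open>v\<close>, with \<open>H *v v\<close> as
  the variation of the gradient.\<close>

definition dsig :: "W \<Rightarrow> W" where
  "dsig v = (2 * dot (kappa g) (H *v v)) *s S - (2 * dot S (H *v v)) *s kappa g
     - (2 * dot S g) *s kappa (H *v v)"

lemma B_sym: "transpose B = B"
  using symmetric_nth[OF sym] by (simp add: block3_nth transpose_def vec_eq_iff forall_3)

lemma Q_g: "Q g = dot g' g'"
  by (simp add: Q_def dot_def sum_3 power2_eq_square)

text \<open>By \<open>gm\<close> the form given by \<open>g\<close> vanishes on the centre
  \<open>m\<close>, so it factors through the projection.\<close>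

lemma dot_P: "dot g' (P x) = dot g x"
proof -
  have "m $ 4 * g $ 4 = - (g $ 1 * m $ 1 + g $ 2 * m $ 2 + g $ 3 * m $ 3)"
    using gm by (simp add: dot_def sum_4) algebra
  then show ?thesis
    using m4 by (simp add: dot_def sum_3 sum_4 proj_from_def field_simps) algebra
qed

lemma P_sig: "P sig = reflect g' s"
  by (simp add: sig_def reflect_def proj_from_linear proj_from_kappa Q_g dot_P dot_commute)

lemma decompose: "x = (x $ 4 / m $ 4) *s m + vector [P x $ 1, P x $ 2, P x $ 3, 0]"
  using m4 by (simp add: vec_eq_iff forall_4 proj_from_def vector_def)

text \<open>By \<open>Hm\<close>, splitting off the component of \<open>x\<close> along
  \<open>m\<close> costs only a multiple of \<open>g'\<close>.\<close>

lemma restr_H: "restr (H *v x) = B *v P x + (c * x $ 4 / m $ 4) *s g'"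
proof -
  have "H *v x = H *v ((x $ 4 / m $ 4) *s m + vector [P x $ 1, P x $ 2, P x $ 3, 0])"
    using decompose by simp
  also have "\<dots> = (c * x $ 4 / m $ 4) *s g + H *v vector [P x $ 1, P x $ 2, P x $ 3, 0]"
    by (simp add: matrix_vector_right_distrib vec.scale Hm mult.commute)
  finally show ?thesis
    by (simp add: restr_linear)
      (simp add: vec_eq_iff forall_3 matrix_vector_mult_def sum_3 sum_4 block3_nth vector_def)
qed

lemma dot_H_m: "dot m (H *v x) = c * dot g x"
proof -
  have "dot m (H *v x) = dot (H *v m) x"
    using symmetric_nth[OF sym]
    by (simp add: dot_def matrix_vector_mult_def sum_distrib_left sum_distrib_right)
       (subst sum.swap, simp add: mult_ac)
  then show ?thesis by (simp add: Hm dot_linear)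
qed

lemma dot_H: "dot x (H *v y) = dot (P x) (restr (H *v y)) + (c * x $ 4 / m $ 4) * dot g y"
proof -
  have "dot x (H *v y) = dot ((x $ 4 / m $ 4) *s m + vector [P x $ 1, P x $ 2, P x $ 3, 0]) (H *v y)"
    using decompose by simp
  also have "\<dots> = (c * x $ 4 / m $ 4) * dot g y + dot (vector [P x $ 1, P x $ 2, P x $ 3, 0]) (H *v y)"
    by (simp add: dot_linear dot_H_m)
  finally show ?thesis by (simp add: dot_def sum_3 sum_4 vector_def)
qed

text \<open>Passing to the block \<open>B\<close> creates two corrections with factor
  \<open>c / m $ 4\<close>, one from \<open>sig $ 4\<close> and one from \<open>dot g sig\<close>.
  They are opposite to each other.\<close>

lemma hess_S_sig: "dot S (H *v sig) = dot s (B *v reflect g' s)"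
proof -
  have "dot g sig = - Q g * dot g S"
    unfolding dot_P[symmetric] P_sig by (simp add: reflect_def dot_linear Q_g dot_commute)
  moreover have "sig $ 4 = Q g * S $ 4" by (simp add: sig_def)
  ultimately show ?thesis
    unfolding dot_H[of S] restr_H P_sig
    using dot_P[of S] by (simp add: dot_linear dot_commute[of s])
qed

text \<open>The multiple of \<open>g'\<close> in \<open>restr_H\<close> enters
  \<open>dreflect\<close>, which turns \<open>g'\<close> into twice the reflected vector; so the
  correction is parallel to \<open>P sig\<close>.\<close>

lemma P_dsig:
  assumes "dot g v = 0"
  shows "P (dsig v) = dreflect g' s (B *v P v) + (2 * c * v $ 4 / m $ 4) *s reflect g' s"
proof -
  have 1: "dot (kappa g) (H *v v) = dot g' (restr (H *v v))"
    by (simp add: dot_def sum_3 sum_4)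
  have 2: "dot S (H *v v) = dot s (restr (H *v v))"
    using assms by (simp add: dot_H)
  show ?thesis
    unfolding dsig_def proj_from_linear proj_from_kappa 1 2 restr_H dreflect_def reflect_def
    by (simp add: dot_linear dot_P vec_eq_iff forall_3 algebra_simps)
      (simp add: dot_commute[of S] dot_commute[of s] dot_P algebra_simps)
qed

lemma det_H: "(m $ 4)\<^sup>2 * det H = - c\<^sup>2 * dot g' (cof B g')"
  using det_symmetric_homogeneous[OF sym Hm] gm by (simp add: dot_def block3_def restr_def)

lemma exists_tangent_form:
  defines "N \<equiv> (\<Sum>i\<in>{1, 2, 3}. (m $ i * S $ 4 - S $ i * m $ 4)\<^sup>2)"
  assumes rel: "dot S g * l0\<^sup>2
      - 2 * (dot S (H *v sig) + (dot S g)\<^sup>2 * (H $ 1 $ 1 + H $ 2 $ 2 + H $ 3 $ 3)) * l0 * l1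
      - (4 / c\<^sup>2 * dot S g * N * det H) * l1\<^sup>2 = 0"
  obtains A where "Vector_Spaces.linear (*s) (*) A" "A \<noteq> (\<lambda>_. 0)" "A m = 0" "A sig = 0"
    "\<And>v. dot g v = 0 \<Longrightarrow> l0 * A v + l1 * A (dsig v) = 0"
proof -
  have "g' \<noteq> 0" using Qg by (auto simp: Q_g dot_linear)
  then obtain u w k where uw: "dot g' u = 0" "dot g' w = 0" "cross u w = k *s g'"
    and span: "\<And>v. dot g' v = 0 \<Longrightarrow> \<exists>a b. v = a *s u + b *s w"
    by (rule orthogonal_plane_basis) blast
  let ?r = "reflect g' s"
  let ?p = "\<lambda>u. l0 *s u + l1 *s dreflect g' s (B *v u)"
  \<comment> \<open>Up to sign, the bases of the squares in \<open>N\<close> are the entries of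
    \<open>m $ 4 *s s\<close>.\<close>
  have N: "N = (m $ 4)\<^sup>2 * dot s s"
    using m4 by (simp add: N_def dot_def sum_3 proj_from_def field_simps power2_eq_square)
  have delta: "dot S g = dot g' s"
    by (simp add: dot_P dot_commute)
  have tr: "H $ 1 $ 1 + H $ 2 $ 2 + H $ 3 $ 3 = trace B"
    by (simp add: trace_def sum_3 block3_nth)
  \<comment> \<open>The factor \<open>(m $ 4)\<^sup>2\<close> of \<open>N\<close> is what
    \<open>det_H\<close> needs next to \<open>det H\<close>, and its \<open>c\<^sup>2\<close>
    cancels the denominator.\<close>
  have gam: "4 / c\<^sup>2 * dot S g * N * det H = - 4 * dot g' s * dot s s * dot g' (cof B g')"
  proof -
    have "4 / c\<^sup>2 * dot S g * N * det H = 4 / c\<^sup>2 * dot g' s * dot s s * ((m $ 4)\<^sup>2 * det H)"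
      by (simp add: N delta)
    then show ?thesis using c by (simp add: det_H)
  qed
  have "dot ?r (cross (?p u) (?p w)) = 0"
    using rel[unfolded gam, unfolded hess_S_sig tr delta]
    unfolding triple_reflect_pencil[OF B_sym uw(3,1,2)] by simp
  then obtain a where a: "a \<noteq> 0" "dot a ?r = 0" "dot a (?p u) = 0" "dot a (?p w) = 0"
    by (rule exists_orthogonal_of_triple_zero)
  define A where "A = (\<lambda>x. dot a (P x))"
  show thesis
  proof (rule that)
    show "Vector_Spaces.linear (*s) (*) A"
      by unfold_locales (simp_all add: A_def proj_from_linear dot_linear algebra_simps)
    show "A \<noteq> (\<lambda>_. 0)"
    proof
      assume A0: "A = (\<lambda>_. 0)"
      \<comment> \<open>The first three unit vectors lie in the plane t = 0, so the projection
        leaves them fixed and \<open>A\<close> recovers \<open>a\<close>.\<close>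
      have "A (axis 1 1) = a $ 1" "A (axis 2 1) = a $ 2" "A (axis 3 1) = a $ 3"
        by (simp_all add: A_def proj_from_def dot_def sum_3 axis_def)
      then show False using A0 \<open>a \<noteq> 0\<close> by (simp add: vec_eq_iff forall_3)
    qed
    show "A m = 0" using m4 by (simp add: A_def proj_from_center dot_linear)
    show "A sig = 0" by (simp add: A_def P_sig a)
    fix v assume v: "dot g v = 0"
    then obtain x y where xy: "P v = x *s u + y *s w"
      using span[of "P v"] by (auto simp: dot_P)
    have lin: "?p (x *s u + y *s w) = x *s ?p u + y *s ?p w"
      by (simp add: dreflect_def matrix_vector_right_distrib vec.scale dot_linear vec_eq_iff forall_3 algebra_simps)
    \<comment> \<open>The correction in \<open>P_dsig\<close> is a multiple of \<open>?r\<close>, to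
      which \<open>a\<close> is orthogonal.\<close>
    have "l0 * A v + l1 * A (dsig v) = dot a (?p (P v))"
      by (simp add: A_def P_dsig[OF v] dot_linear a algebra_simps)
    also have "\<dots> = 0" unfolding xy lin dot_linear(1)[of a "x *s ?p u"] dot_linear(3)[of a x] dot_linear(3)[of a y] a by simp
    finally show "l0 * A v + l1 * A (dsig v) = 0" .
  qed
qed

end

section \<open>Derivatives along the affine cone\<close>

text \<open>At a regular point every tangent vector is the velocity of a curve in the cone; along
  such curves a derivative taken within the cone can be tested.\<close>

lemma curve_with_tangent:
  assumes m: "peval p m = 0" and reg: "peval (pdiff j p) m \<noteq> 0"
    and v: "(\<Sum>i\<in>UNIV. peval (pdiff i p) m * v $ i) = 0"
  obtains \<gamma> :: "real \<Rightarrow> W" and T where "open T" "0 \<in> T" "\<gamma> 0 = m" "\<gamma> ` T \<subseteq> affine_cone p"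
    "(\<gamma> has_derivative (\<lambda>s. s *\<^sub>R v)) (at 0)"
proof -
  define dp where "dp = (\<lambda>x v. \<Sum>i\<in>UNIV. peval (pdiff i p) x * v $ i)"
  \<comment> \<open>A vector transversal to the cone, scaled so that the differential at
    \<open>m\<close> takes the value 1 on it.\<close>
  define n :: W where "n = axis j (inverse (peval (pdiff j p) m))"
  have lin: "linear (dp x)" for x
    by (rule linearI) (simp_all add: dp_def algebra_simps sum.distrib scaleR_sum_right)
  have dp_scale: "dp x (c *s u) = c * dp x u" for x c u
    by (simp add: dp_def sum_distrib_left mult_ac)
  have n: "dp m n = 1"
    using reg by (simp add: dp_def n_def axis_def if_distrib cong: if_cong)
  \<comment> \<open>\<open>f\<close> has derivative \<open>id\<close> at \<open>m\<close> and satisfies \<open>dp m (f x - m) = p x\<close>, so its local inverse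
    maps the affine tangent space at \<open>m\<close> into the cone.\<close>
  define f where "f = (\<lambda>x. x + (peval p x - (dp m x - dp m m)) *s n)"
  define f' where "f' = (\<lambda>x. Blinfun (\<lambda>v. v + (dp x v - dp m v) *s n))"
  have s_bl: "bounded_linear (\<lambda>c::complex. c *s n)"
    by (intro linear_conv_bounded_linear[THEN iffD1] linearI) (simp_all add: vec_eq_iff algebra_simps)
  have bl: "bounded_linear (\<lambda>v. v + (dp x v - dp m v) *s n)" for x
    by (intro bounded_linear_add bounded_linear_ident bounded_linear_compose[OF s_bl]
        bounded_linear_sub linear_conv_bounded_linear[THEN iffD1] lin)
  have f'_apply: "blinfun_apply (f' x) = (\<lambda>v. v + (dp x v - dp m v) *s n)" for x
    unfolding f'_def by (rule bounded_linear_Blinfun_apply[OF bl])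
  have df: "(f has_derivative blinfun_apply (f' x)) (at x)" for x
  proof -
    have "((\<lambda>x. dp m x - dp m m) has_derivative dp m) (at x)"
      using has_derivative_diff[OF bounded_linear_imp_has_derivative[OF
          linear_conv_bounded_linear[THEN iffD1, OF lin[of m]]] has_derivative_const] by simp
    moreover have "(peval p has_derivative dp x) (at x)"
      unfolding dp_def by (rule has_derivative_peval)
    ultimately have "((\<lambda>x. peval p x - (dp m x - dp m m)) has_derivative (\<lambda>v. dp x v - dp m v)) (at x)"
      by (rule has_derivative_diff[rotated])
    from has_derivative_add[OF has_derivative_ident bounded_linear.has_derivative[OF s_bl this]]
    show ?thesis unfolding f_def f'_apply .
  qed
  have cont: "continuous_on UNIV f'"
  proof (rule continuous_on_blinfun_componentwise)
    fix b :: W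
    have "continuous_on UNIV (peval q)" for q
      by (rule has_derivative_continuous_on) (rule has_derivative_peval)
    then have "continuous_on UNIV (\<lambda>x. dp x b)"
      unfolding dp_def by (intro continuous_intros)
    then show "continuous_on UNIV (\<lambda>x. blinfun_apply (f' x) b)"
      unfolding f'_apply
      by (intro continuous_on_add continuous_on_const bounded_linear.continuous_on[OF s_bl]
          continuous_on_diff)
  qed
  have f'm: "blinfun_apply (f' m) = id"
    by (simp add: f'_apply fun_eq_iff)
  then have inv: "id_blinfun o\<^sub>L f' m = id_blinfun"
    by (intro blinfun_eqI) simp
  obtain U' V g g' where "open U'" "U' \<subseteq> UNIV" and U': "m \<in> U'" and V: "open V" "f m \<in> V"
    and hom: "homeomorphism U' V f g" and g: "\<And>y. y \<in> V \<Longrightarrow> (g has_derivative (g' y)) (at y)"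
    and g': "\<And>y. y \<in> V \<Longrightarrow> g' y = inv (blinfun_apply (f' (g y)))"
    and "\<And>y. y \<in> V \<Longrightarrow> bij (blinfun_apply (f' (g y)))"
    using inverse_function_theorem[OF open_UNIV df cont UNIV_I inv] by blast
  have fm: "f m = m" using m by (simp add: f_def)
  have gm: "g m = m" using hom U' fm by (metis homeomorphism_apply1)
  have dg: "(g has_derivative id) (at m)"
    using g[of m] g'[of m] V fm f'm gm by simp
  define \<gamma> where "\<gamma> = (\<lambda>s::real. g (m + s *\<^sub>R v))"
  define T where "T = (\<lambda>s::real. m + s *\<^sub>R v) -` V"
  show thesis
  proof (rule that)
    show "open T"
      unfolding T_def by (intro open_vimage V(1) continuous_intros)
    show "0 \<in> T" using V fm by (simp add: T_def)
    show "\<gamma> 0 = m" by (simp add: \<gamma>_def gm)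
    show "\<gamma> ` T \<subseteq> affine_cone p"
    proof safe
      fix s assume "s \<in> T"
      then have "f (\<gamma> s) = m + s *\<^sub>R v"
        using hom by (simp add: T_def \<gamma>_def homeomorphism_def)
      then have "dp m (f (\<gamma> s) - m) = 0"
        using v lin[of m] by (simp add: linear_cmul) (simp add: dp_def)
      moreover have "dp m (f (\<gamma> s) - m) = peval p (\<gamma> s)"
        using lin[of m] n unfolding f_def
        by (simp add: linear_add linear_diff dp_scale)
      ultimately show "\<gamma> s \<in> affine_cone p" by (simp add: affine_cone_def)
    qed
    have "((\<lambda>s::real. m + s *\<^sub>R v) has_derivative (\<lambda>s. s *\<^sub>R v)) (at 0)"
      by (auto intro!: derivative_eq_intros)
    from has_derivative_compose[OF this, of g id] dg
    show "(\<gamma> has_derivative (\<lambda>s. s *\<^sub>R v)) (at 0)"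
      by (simp add: \<gamma>_def)
  qed
qed

text \<open>Composition with a curve in the cone gives a function of a real variable, whose
  derivative at 0 is unique. Its value at 1 is the derivative of \<open>f\<close> in the direction
  \<open>v\<close>.\<close>

lemma derivative_along_cone_unique:
  assumes D: "(f has_derivative D) (at m within affine_cone p)"
    and D': "(f has_derivative D') (at m within affine_cone p)"
    and "peval p m = 0" "peval (pdiff j p) m \<noteq> 0" "(\<Sum>i\<in>UNIV. peval (pdiff i p) m * v $ i) = 0"
  shows "D v = D' v"
proof -
  obtain \<gamma> :: "real \<Rightarrow> W" and T where T: "open T" "0 \<in> T" and \<gamma>: "\<gamma> 0 = m" "\<gamma> ` T \<subseteq> affine_cone p"
    and d\<gamma>: "(\<gamma> has_derivative (\<lambda>s. s *\<^sub>R v)) (at 0)"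
    using curve_with_tangent[OF assms(3-5)] .
  have "((f \<circ> \<gamma>) has_derivative (E \<circ> (\<lambda>s. s *\<^sub>R v))) (at 0)"
    if "(f has_derivative E) (at m within affine_cone p)" for E
  proof -
    have "(f has_derivative E) (at (\<gamma> 0) within \<gamma> ` T)"
      using has_derivative_subset[OF that \<gamma>(2)] by (simp add: \<gamma>(1))
    from diff_chain_within[OF has_derivative_at_withinI[OF d\<gamma>] this]
    show ?thesis by (simp add: at_within_open[OF T(2,1)])
  qed
  from fun_cong[OF has_derivative_unique[OF this[OF D] this[OF D']], of 1]
  show ?thesis by simp
qed

section \<open>Differentiating the map sigma\<close>

lemma has_derivative_vecI:
  fixes f :: "'a::real_normed_vector \<Rightarrow> 'b::euclidean_space ^ 'n"
  assumes "\<And>i. ((\<lambda>x. f x $ i) has_derivative (\<lambda>v. f' v $ i)) (at m within X)"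
  shows "(f has_derivative f') (at m within X)"
proof (subst has_derivative_componentwise_within, rule ballI)
  fix b :: "'b ^ 'n" assume "b \<in> Basis"
  then obtain i u where b: "b = axis i u" by (auto simp: Basis_vec_def)
  from bounded_linear.has_derivative[OF bounded_linear_inner_left assms[of i], of u]
  show "((\<lambda>x. f x \<bullet> b) has_derivative (\<lambda>v. f' v \<bullet> b)) (at m within X)"
    by (simp add: b inner_axis)
qed

text \<open>Bilinearity is over the reals although the scalars are complex, which lets the real
  product rule apply.\<close>

lemma bounded_bilinear_vector_scalar_mult:
  "bounded_bilinear ((*s) :: complex \<Rightarrow> complex ^ 'n \<Rightarrow> complex ^ 'n)"
  by (subst bilinear_conv_bounded_bilinear[symmetric])
    (auto simp: bilinear_def vec_eq_iff algebra_simps intro!: linearI)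

lemma bounded_bilinear_dot: "bounded_bilinear (dot :: complex ^ 'n \<Rightarrow> complex ^ 'n \<Rightarrow> complex)"
  by (subst bilinear_conv_bounded_bilinear[symmetric])
    (auto simp: bilinear_def dot_def scaleR_sum_right sum.distrib algebra_simps intro!: linearI)

lemma bounded_linear_kappa: "bounded_linear (kappa :: W \<Rightarrow> W)"
  by (intro linear_conv_bounded_linear[THEN iffD1] linearI) (simp_all add: vec_eq_iff forall_4)

context homogeneous_hessian
begin

lemma has_derivative_sig:
  assumes G: "(G has_derivative (*v) H) (at m within X)" and g: "G m = g"
  shows "((\<lambda>x. Q (G x) *s S - (2 * dot S (G x)) *s kappa (G x)) has_derivative dsig) (at m within X)"
proof -
  note scale = bounded_bilinear.FDERIV[OF bounded_bilinear_vector_scalar_mult]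
  have kap: "((\<lambda>x. kappa (G x)) has_derivative (\<lambda>v. kappa (H *v v))) (at m within X)"
    by (rule bounded_linear.has_derivative[OF bounded_linear_kappa G])
  \<comment> \<open>Written as a bilinear expression, \<open>Q\<close> falls under the product rule;
    its two summands agree, whence the factor 2.\<close>
  have "Q y = dot (kappa y) y" for y :: W
    by (simp add: Q_def dot_def sum_4 power2_eq_square)
  moreover have "dot (kappa (H *v v)) g = dot (kappa g) (H *v v)" for v
    by (simp add: dot_def sum_4 mult.commute)
  ultimately have Q: "((\<lambda>x. Q (G x)) has_derivative (\<lambda>v. 2 * dot (kappa g) (H *v v))) (at m within X)"
    using bounded_bilinear.FDERIV[OF bounded_bilinear_dot kap G] by (simp add: g)
  have "((\<lambda>x. dot S (G x)) has_derivative (\<lambda>v. dot S (H *v v))) (at m within X)"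
    by (rule bounded_linear.has_derivative[OF
          bounded_bilinear.bounded_linear_right[OF bounded_bilinear_dot] G])
  then have Delta: "((\<lambda>x. 2 * dot S (G x)) has_derivative (\<lambda>v. 2 * dot S (H *v v))) (at m within X)"
    by (rule has_derivative_mult_right)
  have "((\<lambda>x. Q (G x) *s S) has_derivative (\<lambda>v. (2 * dot (kappa g) (H *v v)) *s S)) (at m within X)"
    using scale[OF Q has_derivative_const[of S]] by simp
  from has_derivative_diff[OF this scale[OF Delta kap]]
  show ?thesis
    by (simp add: g dsig_def [abs_def] algebra_simps)
qed

end

section \<open>Tangency of the reflected line\<close>

text \<open>Membership in \<open>V p\<close> only provides some representative on which
  \<open>p\<close> vanishes; homogeneity carries this over to \<open>m\<close>.\<close>

lemma peval_V:
  assumes "homogeneous_of_degree d p" "pt m \<in> V p"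
  shows "peval p m = 0"
proof -
  obtain n where n: "pt m = pt n" "peval p n = 0" using assms(2) by (auto simp: V_def)
  have "m \<in> vec.span {n}" using n(1) vec.span_base[of m "{m}"] by (simp add: pt_def)
  then obtain c where "m = c *s n" by (auto simp: vec.span_singleton)
  then show ?thesis using peval_scale[OF assms(1)] n(2) by simp
qed

lemma homogeneous_alpha_beta_gamma:
  assumes F: "homogeneous_of_degree d F" and d: "d \<ge> 2"
  shows "homogeneous_of_degree (d - 1) (alpha F S)"
    and "homogeneous_of_degree (3 * d - 4) (beta F S)"
    and "homogeneous_of_degree (5 * d - 7) (gamma d F S)"
proof -
  \<comment> \<open>This removes the truncated subtractions: the three degrees become k + 1, 3k + 2
    and 5k + 3.\<close>
  obtain k where k: "d = k + 2" using d by (metis add.commute le_Suc_ex)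
  have D1: "homogeneous_of_degree (k + 1) (pdiff i F)" for i
    using homogeneous_pdiff[OF F, of i] k by simp
  have D2: "homogeneous_of_degree k (pdiff i (pdiff j F))" for i j
    using homogeneous_pdiff[OF D1, of i j] by simp
  have Cst: "homogeneous_of_degree n (Cst c * p)" if "homogeneous_of_degree n p" for n c p
    using homogeneous_mult[OF homogeneous_Cst that] by simp
  have num: "homogeneous_of_degree n (numeral w * p)" if "homogeneous_of_degree n p" for n w p
    using homogeneous_mult[OF homogeneous_of_nat[of "numeral w"] that] by simp
  have pow2: "homogeneous_of_degree (2 * n) (p\<^sup>2)" if "homogeneous_of_degree n p" for n p
    using homogeneous_power[OF that] .
  have Delta: "homogeneous_of_degree (k + 1) (Delta S F)"
    unfolding Delta_def by (intro homogeneous_sum Cst D1)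
  have Qg: "homogeneous_of_degree (2 * (k + 1)) (Q (grad F))"
    unfolding Q_def grad_def by (simp only: vec_lambda_beta) (intro homogeneous_add pow2 D1)
  have kap: "homogeneous_of_degree (k + 1) (kappa (grad F) $ i)" for i
    using exhaust_4[of i] D1 by (auto simp: grad_def)
  have sig: "homogeneous_of_degree (2 * (k + 1)) (sigma F S $ i)" for i
  proof -
    have "homogeneous_of_degree (2 * (k + 1)) (Q (grad F) * Cst (S $ i))"
      by (subst mult.commute) (rule Cst[OF Qg])
    moreover have "homogeneous_of_degree (2 * (k + 1)) (2 * Delta S F * kappa (grad F) $ i)"
      unfolding mult_2[of "k + 1"] by (intro homogeneous_mult num Delta kap)
    ultimately show ?thesis
      by (auto simp: sigma_def cvec_def intro: homogeneous_diff)
  qed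
  show "homogeneous_of_degree (d - 1) (alpha F S)"
    using Delta by (simp add: alpha_def k)
  have "homogeneous_of_degree (k + 2 * (k + 1)) (Hess F (cvec S) (sigma F S))"
    unfolding Hess_def Hess_matrix_def cvec_def
    by (intro homogeneous_sum homogeneous_mult sig)
      (simp_all add: D2 mult.commute[of _ "Cst _"] Cst)
  moreover have "homogeneous_of_degree (2 * (k + 1) + k)
      ((Delta S F)\<^sup>2 * (pdiff 1 (pdiff 1 F) + pdiff 2 (pdiff 2 F) + pdiff 3 (pdiff 3 F)))"
    by (intro homogeneous_mult homogeneous_add pow2 Delta D2)
  ultimately have "homogeneous_of_degree (k + 2 * (k + 1)) (- beta F S)"
    unfolding beta_def minus_mult_left minus_minus
    by (intro num homogeneous_add) (simp_all add: add.commute)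
  from homogeneous_uminus[OF this] show "homogeneous_of_degree (3 * d - 4) (beta F S)"
    by (simp add: k)
  have "homogeneous_of_degree 1 (Var i * Cst a - Cst b * Var j)" for i j a b
    using homogeneous_diff[OF Cst[OF homogeneous_Var] Cst[OF homogeneous_Var]]
    by (simp add: mult.commute)
  then have "homogeneous_of_degree (2 * 1) (NS S)"
    unfolding NS_def by (intro homogeneous_add pow2)
  moreover have "homogeneous_of_degree (4 * k) (det (Hess_matrix F))"
    using homogeneous_det[of k "Hess_matrix F"] D2 by (simp add: Hess_matrix_def)
  ultimately have "homogeneous_of_degree (k + 1 + 2 * 1 + 4 * k) (gamma d F S)"
    unfolding gamma_def by (intro homogeneous_uminus homogeneous_mult Cst Delta)
  moreover have "k + 1 + 2 * 1 + 4 * k = 5 * d - 7"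
    by (simp add: k)
  ultimately show "homogeneous_of_degree (5 * d - 7) (gamma d F S)"
    by simp
qed

theorem theorem15:
  fixes F :: SymW and d :: nat and S :: W
    and U :: "W set set" and \<psi> :: "W set \<Rightarrow> W set"
    and \<iota> :: "SymW \<Rightarrow> 'b::comm_ring_1" and ev :: "W \<Rightarrow> 'b \<Rightarrow> complex"
    and l\<^sub>0 l\<^sub>1 :: 'b and \<Psi> :: "W \<Rightarrow> W"
  assumes "F \<noteq> 0" and "homogeneous_of_degree d F" and "d \<ge> 2" and "S \<noteq> 0"
    and "U \<subseteq> V F"
    and "integral_extension \<iota>" and "evaluation_over \<iota> ev"
    and "\<And>m. \<Psi> m = ev m l\<^sub>0 *s m + ev m l\<^sub>1 *s sigma_at F S m"
    and "\<And>m. m \<noteq> 0 \<Longrightarrow> pt m \<in> U \<Longrightarrow> \<Psi> m \<noteq> 0 \<and> \<psi> (pt m) = pt (\<Psi> m)"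
    and "\<And>m. m \<noteq> 0 \<Longrightarrow> pt m \<in> U \<Longrightarrow>
           peval (alpha F S) m * (ev m l\<^sub>0)\<^sup>2
         + peval (beta F S) m * ev m l\<^sub>0 * ev m l\<^sub>1
         + peval (gamma d F S) m * (ev m l\<^sub>1)\<^sup>2 = 0"
  shows "homogeneous_of_degree (d - 1) (alpha F S) \<and>
         homogeneous_of_degree (3 * d - 4) (beta F S) \<and>
         homogeneous_of_degree (5 * d - 7) (gamma d F S) \<and>
         (\<forall>m. m \<noteq> 0 \<longrightarrow> pt m \<in> U - V (Var 4 * Q (grad F)) \<longrightarrow>
            (\<lambda>x. ev x l\<^sub>0) differentiable (at m within affine_cone F) \<longrightarrow>
            (\<lambda>x. ev x l\<^sub>1) differentiable (at m within affine_cone F) \<longrightarrow>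
            reflected_line_tangent F S \<Psi> m)"
proof (intro conjI allI impI)
  show "homogeneous_of_degree (d - 1) (alpha F S)"
    "homogeneous_of_degree (3 * d - 4) (beta F S)"
    "homogeneous_of_degree (5 * d - 7) (gamma d F S)"
    using homogeneous_alpha_beta_gamma assms(2,3) by blast+
next
  fix m :: W
  assume m0: "m \<noteq> 0" and mU: "pt m \<in> U - V (Var 4 * Q (grad F))"
    and diff: "(\<lambda>x. ev x l\<^sub>0) differentiable (at m within affine_cone F)"
      "(\<lambda>x. ev x l\<^sub>1) differentiable (at m within affine_cone F)"
  note F = assms(2)
  define g :: W where "g = (\<chi> i. peval (pdiff i F) m)"
  define H :: "complex ^ 4 ^ 4" where "H = (\<chi> i j. peval (pdiff i (pdiff j F)) m)"
  define c :: complex where "c = of_nat d - 1"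
  have Fm: "peval F m = 0"
    using peval_V[OF F] mU assms(5) by auto
  have "peval (Var 4 * Q (grad F)) m \<noteq> 0"
    using mU m0 by (auto simp: V_def)
  then have m4: "m $ 4 \<noteq> 0" and Qg: "Q g \<noteq> 0"
    by (simp_all add: Q_def grad_def g_def)
  have c0: "c \<noteq> 0"
    using assms(3) by (auto simp: c_def)
  have sym: "transpose H = H"
    by (simp add: H_def transpose_def vec_eq_iff) (metis pdiff_commute)
  have Hm: "H *v m = c *s g"
  proof (subst vec_eq_iff, rule allI)
    fix i
    \<comment> \<open>After exchanging derivatives, row \<open>i\<close> of the Hessian is the
      gradient of the i-th partial derivative, to which Euler's relation applies in degree d -
      1.\<close>
    have "(H *v m) $ i = (\<Sum>j\<in>UNIV. peval (pdiff j (pdiff i F)) m * m $ j)"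
      by (simp add: matrix_vector_mult_def H_def pdiff_commute[of i])
    also have "\<dots> = of_nat (d - 1) * g $ i"
      using euler_homogeneous[OF homogeneous_pdiff[OF F]] by (simp add: g_def)
    finally show "(H *v m) $ i = (c *s g) $ i"
      using assms(3) by (simp add: c_def of_nat_diff algebra_simps)
  qed
  have gm: "dot g m = 0"
    using euler_homogeneous[OF F, of m] Fm by (simp add: dot_def g_def)
  interpret homogeneous_hessian g m S H c
    by unfold_locales (use sym Hm gm m4 c0 Qg in auto)
  have Delta: "peval (Delta S F) x = dot S (\<chi> i. peval (pdiff i F) x)" for x
    by (simp add: Delta_def dot_def)
  have sigma: "sigma_at F S x = Q (\<chi> i. peval (pdiff i F) x) *s S
      - (2 * dot S (\<chi> i. peval (pdiff i F) x)) *s kappa (\<chi> i. peval (pdiff i F) x)" for x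
    by (simp add: sigma_at_def sigma_def vec_eq_iff forall_4 Q_def grad_def cvec_def Delta)
  have sig: "sigma_at F S m = sig"
    by (simp only: sigma sig_def flip: g_def)
  have sigc: "peval (sigma F S $ i) m = sig $ i" for i
    by (simp add: sigma_at_def flip: sig)
  let ?l0 = "ev m l\<^sub>0" and ?l1 = "ev m l\<^sub>1"
  have "peval (Hess F (cvec S) (sigma F S)) m = dot S (H *v sig)"
    by (simp add: Hess_def Hess_matrix_def cvec_def sigc dot_def matrix_vector_mult_def
        H_def sum_distrib_left mult_ac)
  then have beta: "peval (beta F S) m =
      - 2 * (dot S (H *v sig) + (dot S g)\<^sup>2 * (H $ 1 $ 1 + H $ 2 $ 2 + H $ 3 $ 3))"
    by (simp add: beta_def Delta g_def H_def)
  have N: "peval (NS S) m = (\<Sum>i\<in>{1, 2, 3}. (m $ i * S $ 4 - S $ i * m $ 4)\<^sup>2)"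
    by (simp add: NS_def)
  have "peval (det (Hess_matrix F)) m = det H"
    by (simp add: peval_det Hess_matrix_def H_def)
  then have gamma: "peval (gamma d F S) m = - (4 / c\<^sup>2 * dot S g
      * (\<Sum>i\<in>{1, 2, 3}. (m $ i * S $ 4 - S $ i * m $ 4)\<^sup>2) * det H)"
    by (simp only: gamma_def peval_uminus peval_mult peval_Cst N Delta g_def c_def)
  have "peval (alpha F S) m * ?l0\<^sup>2 + peval (beta F S) m * ?l0 * ?l1 + peval (gamma d F S) m * ?l1\<^sup>2 = 0"
    using assms(10) m0 mU by blast
  then have "dot S g * ?l0\<^sup>2
      - 2 * (dot S (H *v sig) + (dot S g)\<^sup>2 * (H $ 1 $ 1 + H $ 2 $ 2 + H $ 3 $ 3)) * ?l0 * ?l1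
      - (4 / c\<^sup>2 * dot S g * (\<Sum>i\<in>{1, 2, 3}. (m $ i * S $ 4 - S $ i * m $ 4)\<^sup>2) * det H) * ?l1\<^sup>2 = 0"
    unfolding beta gamma alpha_def Delta g_def[symmetric] by (simp only: minus_mult_left diff_conv_add_uminus)
  then obtain A where A: "Vector_Spaces.linear (*s) (*) A" "A \<noteq> (\<lambda>_. 0)" "A m = 0" "A sig = 0"
    "\<And>v. dot g v = 0 \<Longrightarrow> ?l0 * A v + ?l1 * A (dsig v) = 0"
    by (rule exists_tangent_form) blast
  interpret A: Vector_Spaces.linear "(*s)" "(*)" A by fact
  let ?at = "at m within affine_cone F"
  obtain d0 d1 where d0: "((\<lambda>x. ev x l\<^sub>0) has_derivative d0) ?at"
    and d1: "((\<lambda>x. ev x l\<^sub>1) has_derivative d1) ?at"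
    using diff by (auto simp: differentiable_def)
  \<comment> \<open>The derivative of \<open>\<Psi>\<close> from the product rule; its terms with
    \<open>d0\<close> and \<open>d1\<close> are multiples of \<open>m\<close> and
    \<open>sig\<close>, both killed by \<open>A\<close>.\<close>
  define E where "E = (\<lambda>v. ?l0 *s v + d0 v *s m + (?l1 *s dsig v + d1 v *s sig))"
  have dg: "((\<lambda>x. peval (pdiff i F) x) has_derivative (\<lambda>v. (H *v v) $ i)) ?at" for i
  proof -
    have "(H *v v) $ i = (\<Sum>j\<in>UNIV. peval (pdiff j (pdiff i F)) m * v $ j)" for v
      by (simp add: matrix_vector_mult_def H_def pdiff_commute[of i])
    then show ?thesis using has_derivative_peval[of "pdiff i F" m "affine_cone F"] by simp
  qed
  have "((\<lambda>x. \<chi> i. peval (pdiff i F) x) has_derivative (*v) H) ?at"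
    by (rule has_derivative_vecI) (simp add: dg)
  from has_derivative_sig[OF this g_def[symmetric]] have dsigma: "(sigma_at F S has_derivative dsig) ?at"
    by (simp only: flip: sigma)
  note scale = bounded_bilinear.FDERIV[OF bounded_bilinear_vector_scalar_mult]
  have "((\<lambda>x. ev x l\<^sub>0 *s x + ev x l\<^sub>1 *s sigma_at F S x) has_derivative
      (\<lambda>v. (?l0 *s v + d0 v *s m) + (?l1 *s dsig v + d1 v *s sigma_at F S m))) ?at"
    by (rule has_derivative_add[OF scale[OF d0 has_derivative_ident] scale[OF d1 dsigma]])
  then have dPsi: "(\<Psi> has_derivative E) ?at"
    unfolding E_def sig ext[of \<Psi>, OF assms(8)] .
  show "reflected_line_tangent F S \<Psi> m"
    unfolding reflected_line_tangent_def
  proof (intro conjI allI impI)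
    show "\<Psi> differentiable ?at"
      using dPsi by (auto simp: differentiable_def)
    fix D assume D: "(\<Psi> has_derivative D) ?at"
    \<comment> \<open>Since \<open>Q g\<close> \<noteq> 0, some spatial partial derivative is
      nonzero, so the cone is regular at \<open>m\<close>.\<close>
    obtain j where j: "peval (pdiff j F) m \<noteq> 0"
      using Qg by (fastforce simp: Q_def g_def)
    have "A (D v) = 0" if v: "(\<Sum>i\<in>UNIV. peval (pdiff i F) m * v $ i) = 0" for v
    proof -
      \<comment> \<open>\<open>D\<close> is an arbitrary derivative within the cone; agreement with
        \<open>E\<close> is needed only on tangent vectors.\<close>
      have "D v = E v"
        by (rule derivative_along_cone_unique[OF D dPsi Fm j v])
      also have "A (E v) = ?l0 * A v + ?l1 * A (dsig v)"
        by (simp add: E_def A.add A.scale A(3,4))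
      also have "\<dots> = 0"
        using A(5)[of v] v by (simp add: dot_def g_def)
      finally show ?thesis .
    qed
    then show "\<exists>A. Vector_Spaces.linear (*s) (*) A \<and> A \<noteq> (\<lambda>_. 0) \<and> A m = 0 \<and> A (sigma_at F S m) = 0 \<and>
        (\<forall>v. (\<Sum>i\<in>UNIV. peval (pdiff i F) m * v $ i) = 0 \<longrightarrow> A (D v) = 0)"
      using A sig by (intro exI[of _ A]) simp
  qed
qed

end
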